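(* If $n$ is a prime power, then $\mathsf{D}_n^{\times}=\eta_n^{\times}=2n-1$.
   Context: A prime power is $n=p^e$ with $p$ prime and $e\ge 1$. For an integer $n\ge 2$: - $\mathsf{D}_n^{\times}$ is the smallest positive integer $\ell$ such that, from any given $\ell$ integers (repetitions allowed) all coprime to $n$, one can select some of them (a non-empty sub-multiset) whose sum $\sigma$ satisfies $\gcd(\sigma,n^2)=n$. - $\eta_n^{\times}$ is the smallest positive integer $\ell$ such that, from any given $\ell$ integers (repetitions allowed) all coprime to $n$, one can select at most $n$ of them (and at least one) whose sum $\sigma$ satisfies $\gcd(\sigma,n^2)=n$. *)

theory Defs
  imports "HOL-Library.Multiset" "HOL-Number_Theory.Prime_Powers"
begin

text \<open>
  Families of integers with repetitions are multisets; selecting some of them means taking a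
  sub-multiset. The smallest admissible length is taken with \<open>Inf\<close> on the naturals: it is the
  minimum of the set if that is non-empty, and \<open>0\<close> otherwise, so a positive value is
  always an attained minimum.
\<close>

definition D_unit :: "nat \<Rightarrow> nat" where
  "D_unit n = Inf {l. l > 0 \<and>
     (\<forall>S :: int multiset. size S = l \<longrightarrow> (\<forall>a \<in># S. coprime a (int n)) \<longrightarrow>
        (\<exists>T. T \<subseteq># S \<and> T \<noteq> {#} \<and> gcd (\<Sum>\<^sub># T) ((int n)\<^sup>2) = int n))}"

definition eta_unit :: "nat \<Rightarrow> nat" where
  "eta_unit n = Inf {l. l > 0 \<and>
     (\<forall>S :: int multiset. size S = l \<longrightarrow> (\<forall>a \<in># S. coprime a (int n)) \<longrightarrow>
        (\<exists>T. T \<subseteq># S \<and> T \<noteq> {#} \<and> size T \<le> n \<and> gcd (\<Sum>\<^sub># T) ((int n)\<^sup>2) = int n))}"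

end

theory Submission
  imports Defs "HOL-Computational_Algebra.Polynomial"
begin

text \<open>
  Write \<open>n = p ^ e\<close>. The sequence of \<open>n - 1\<close> ones and \<open>n - 1\<close> minus ones gives the lower bound,
  since all its subsums that are divisible by \<open>n\<close> vanish.

  For the upper bound consider the polynomial
  \<open>P(x) = (x - 1 choose n - 1) (x choose n)\<close>. From \<open>x (x - 1 choose n - 1) = n (x choose n)\<close>
  one sees that \<open>p\<close> divides \<open>P(s)\<close> for every integer \<open>s\<close> with \<open>gcd(s, n\<^sup>2) \<noteq> n\<close>.
  As \<open>P\<close> has degree \<open>2 n - 1\<close>, its iterated difference with steps
  \<open>a\<^sub>1, \<dots>, a\<^sub>2\<^sub>n\<^sub>-\<^sub>1\<close> is the constant \<open>(2 n - 1 choose n) a\<^sub>1 \<cdots> a\<^sub>2\<^sub>n\<^sub>-\<^sub>1\<close>,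
  which is not divisible by \<open>p\<close>; but it is an alternating sum of the values of \<open>P\<close> at the
  subsums, so some subsum \<open>s\<close> has \<open>gcd(s, n\<^sup>2) = n\<close>.
  Finally, a selection of more than \<open>n\<close> terms contains a selection of at most \<open>n\<close> terms with sum
  divisible by \<open>n\<close>; either this one is as desired, or it can be removed.
\<close>

section \<open>Iterated differences of polynomials\<close>

text \<open>The bound \<open>m\<close> may exceed the degree, so the lemma can be iterated even
  after a difference lowers the degree by more than one.\<close>

lemma coeff_pcompose_shift_diff:
  fixes P :: "'a::comm_ring_1 poly"
  assumes "degree P \<le> m"
  shows "\<And>k. k \<ge> m \<Longrightarrow> coeff (pcompose P [:a, 1:] - P) k = 0"
    and "coeff (pcompose P [:a, 1:] - P) (m - 1) = of_nat m * a * coeff P m"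
proof -
  let ?D = "\<lambda>P. pcompose P [:a, 1:] - P"
  have "(\<forall>k\<ge>m. coeff (?D P) k = 0) \<and> coeff (?D P) (m - 1) = of_nat m * a * coeff P m"
    using assms
  proof (induction P arbitrary: m)
    case 0
    then show ?case by simp
  next
    case (pCons c P)
    \<comment> \<open>From (x + a) P(x + a) - x P(x) = x (P(x + a) - P(x)) + a P(x + a); the
      constant \<open>c\<close> cancels.\<close>
    have eq: "?D (pCons c P) = pCons 0 (?D P) + smult a (?D P + P)"
      by (simp add: pcompose_pCons algebra_simps smult_diff_right)
    show ?case
    proof (cases m)
      case 0
      with pCons.prems pCons.hyps have "P = 0"
        by (auto split: if_splits)
      with 0 show ?thesis by (simp add: pcompose_pCons)
    next
      case (Suc k)
      with pCons.prems have "degree P \<le> k"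
        by (auto split: if_splits)
      note IH = pCons.IH[OF this]
      have "coeff P i = 0" if "i > k" for i
        using that \<open>degree P \<le> k\<close> by (intro coeff_eq_0) auto
      with IH Suc show ?thesis
        unfolding eq by (cases k) (auto simp: coeff_pCons algebra_simps split: nat.splits)
    qed
  qed
  then show "\<And>k. k \<ge> m \<Longrightarrow> coeff (?D P) k = 0"
    "coeff (?D P) (m - 1) = of_nat m * a * coeff P m"
    by auto
qed

lemma dvd_iterated_difference:
  fixes P :: "int poly"
  assumes "degree P \<le> size S" "\<And>T. T \<subseteq># S \<Longrightarrow> M dvd poly P (\<Sum>\<^sub># T)"
  shows "M dvd fact (size S) * coeff P (size S) * \<Prod>\<^sub># S"
  using assms
proof (induction S arbitrary: P)
  case empty
  then show ?case
    by (auto simp: poly_0_coeff_0)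
next
  case (add a S)
  let ?Q = "pcompose P [:a, 1:] - P"
  have "degree ?Q \<le> size S"
    using coeff_pcompose_shift_diff(1)[OF add.prems(1)] by (intro degree_le) (simp add: Suc_le_eq)
  moreover have "M dvd poly ?Q (\<Sum>\<^sub># T)" if "T \<subseteq># S" for T
  proof -
    \<comment> \<open>The value of \<open>?Q\<close> at the sum of \<open>T\<close> is the
      difference of \<open>P\<close> at these two subsums.\<close>
    have "add_mset a T \<subseteq># add_mset a S" "T \<subseteq># add_mset a S"
      using that by (auto intro: subset_mset.order_trans)
    from this[THEN add.prems(2)] show ?thesis
      by (simp add: poly_pcompose)
  qed
  ultimately have "M dvd fact (size S) * coeff ?Q (size S) * \<Prod>\<^sub># S"
    by (rule add.IH)
  moreover have "coeff ?Q (size S) = of_nat (Suc (size S)) * a * coeff P (Suc (size S))"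
    using coeff_pcompose_shift_diff(2)[OF add.prems(1), of a] by simp
  ultimately show ?case
    by (simp add: algebra_simps)
qed

section \<open>Binomial coefficients and divisibility by powers of \<open>p\<close>\<close>

text \<open>
  This is \<open>s gchoose k\<close>; the library's type constraint on \<open>gchoose\<close> admits only fields here.
\<close>

definition int_choose :: "int \<Rightarrow> nat \<Rightarrow> int" (infix "ichoose" 64)
  where "s ichoose k = (\<Prod>i = 0..<k. s - int i) div fact k"

lemma ichoose_mult_fact: "fact k * (s ichoose k) = (\<Prod>i = 0..<k. s - int i)"
proof -
  have "fact k dvd (\<Prod>i = 0..<k. s - int i)"
    unfolding gbinomial_int_mult_fact[symmetric] by (rule dvd_triv_left)
  then show ?thesis
    by (simp add: int_choose_def)
qed

text \<open>Multiplied by \<open>fact (n - 1)\<close>, both sides become s (s - 1) ... (s - n +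
  1).\<close>

lemma mult_ichoose_absorb:
  fixes s :: int
  assumes "n > 0"
  shows "s * ((s - 1) ichoose (n - 1)) = int n * (s ichoose n)"
proof -
  obtain m where n: "n = Suc m"
    using assms gr0_implies_Suc by blast
  have "fact m * (s * ((s - 1) ichoose m)) = s * (\<Prod>i = 0..<m. s - 1 - int i)"
    by (simp add: ichoose_mult_fact mult.left_commute)
  also have "\<dots> = (\<Prod>i = 0..<Suc m. s - int i)"
    unfolding prod.atLeast0_lessThan_Suc_shift by (simp add: algebra_simps)
  also have "\<dots> = fact (Suc m) * (s ichoose Suc m)"
    by (simp only: ichoose_mult_fact)
  also have "\<dots> = fact m * (int (Suc m) * (s ichoose Suc m))"
    by (simp add: algebra_simps)
  finally have "s * ((s - 1) ichoose m) = int (Suc m) * (s ichoose Suc m)"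
    by (simp del: of_nat_Suc)
  with n show ?thesis by simp
qed

text \<open>The cofactor of \<open>p ^ e\<close> in \<open>s\<close> is prime to \<open>p\<close>,
  so it adds nothing to the gcd. Existence arguments can thus work with exact divisibility.\<close>

lemma gcd_prime_power_square_eq:
  fixes s :: int
  assumes "prime p" "int (p ^ e) dvd s" "\<not> int (p * p ^ e) dvd s"
  shows "gcd s ((int (p ^ e))\<^sup>2) = int (p ^ e)"
proof -
  obtain k where k: "s = int (p ^ e) * k"
    using assms(2) by blast
  with assms(3) have "\<not> int p dvd k"
    by (metis dvd_refl mult.commute mult_dvd_mono of_nat_mult)
  with assms(1) have "coprime (int p) k"
    by (intro prime_imp_coprime) auto
  then have "coprime k (int (p ^ e))"
    by (simp add: coprime_commute)
  then have "gcd (int (p ^ e) * k) (int (p ^ e) * int (p ^ e)) = int (p ^ e)"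
    unfolding gcd_mult_distrib_int[symmetric] by (simp add: coprime_iff_gcd_eq_1)
  with k show ?thesis by (simp add: power2_eq_square)
qed

text \<open>Both cases use the absorption identity. If \<open>p * p ^ e\<close> divides
  \<open>s\<close>, cancelling \<open>p ^ e\<close> leaves a factor \<open>p\<close> in
  \<open>B\<close>; if \<open>p ^ e\<close> does not divide \<open>s\<close>, then \<open>C\<close>
  cannot be prime to \<open>p\<close>.\<close>

lemma prime_dvd_ichoose_product:
  fixes s :: int
  assumes "prime p" "\<not> (int (p ^ e) dvd s \<and> \<not> int (p * p ^ e) dvd s)"
  shows "int p dvd ((s - 1) ichoose (p ^ e - 1)) * (s ichoose (p ^ e))"
proof -
  define C where "C = (s - 1) ichoose (p ^ e - 1)"
  define B where "B = s ichoose (p ^ e)"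
  have pos: "p ^ e > 0"
    using assms(1) prime_gt_0_nat by simp
  have absorb: "s * C = int (p ^ e) * B"
    unfolding B_def C_def using pos by (rule mult_ichoose_absorb)
  consider "int (p * p ^ e) dvd s" | "\<not> int (p ^ e) dvd s"
    using assms(2) by blast
  then have "int p dvd C * B"
  proof cases
    case 1
    then obtain k where "s = int (p * p ^ e) * k" by blast
    with absorb have "int (p ^ e) * (int p * k * C) = int (p ^ e) * B"
      by (simp add: ac_simps)
    with pos have "int p * k * C = B" by auto
    then show ?thesis by auto
  next
    case 2
    have "int p dvd C"
    proof (rule ccontr)
      assume "\<not> int p dvd C"
      with assms(1) have "coprime (int p) C"
        by (intro prime_imp_coprime) auto
      then have "coprime (int (p ^ e)) C" by simp
      moreover have "int (p ^ e) dvd s * C"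
        using absorb by simp
      ultimately show False
        using 2 coprime_dvd_mult_left_iff by blast
    qed
    then show ?thesis by simp
  qed
  then show ?thesis
    by (simp add: B_def C_def)
qed

text \<open>With \<open>q = p ^ e\<close>, expand \<open>(q + (q - 1)) choose q\<close> by
  Vandermonde: terms with 0 < i < q are divisible by \<open>p\<close>, the term i = 0 vanishes and i
  = q gives 1.\<close>

lemma prime_not_dvd_choose_twice_prime_power:
  assumes "prime p"
  shows "\<not> p dvd (2 * p ^ e - 1) choose (p ^ e)"
proof
  define q where "q = p ^ e"
  have q: "q > 0"
    using assms prime_gt_0_nat by (simp add: q_def)
  have dvd: "p dvd q choose i" if "0 < i" "i < q" for i
  proof (rule ccontr)
    assume "\<not> p dvd q choose i"
    with assms have "coprime q (q choose i)"
      by (simp add: q_def prime_imp_coprime)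
    moreover have "q dvd i * (q choose i)"
      using times_binomial_minus1_eq[of i q] that by simp
    ultimately have "q dvd i"
      using coprime_dvd_mult_left_iff by blast
    with that show False
      using dvd_imp_le by fastforce
  qed
  assume "p dvd (2 * p ^ e - 1) choose (p ^ e)"
  also have "2 * p ^ e - 1 = q + (q - 1)"
    using q by (simp add: q_def)
  also have "p ^ e = q" by (simp add: q_def)
  also have "(q + (q - 1)) choose q = (\<Sum>i\<le>q. (q choose i) * ((q - 1) choose (q - i)))"
    by (rule vandermonde[symmetric])
  also have "\<dots> = (\<Sum>i<q. (q choose i) * ((q - 1) choose (q - i))) + 1"
    unfolding lessThan_Suc_atMost[symmetric] by simp
  finally have "p dvd (\<Sum>i<q. (q choose i) * ((q - 1) choose (q - i))) + 1" .
  moreover have "p dvd (q choose i) * ((q - 1) choose (q - i))" if "i < q" for i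
    using dvd[of i] that q by (cases "i = 0") (auto simp: binomial_eq_0)
  then have "p dvd (\<Sum>i<q. (q choose i) * ((q - 1) choose (q - i)))"
    by (intro dvd_sum) auto
  ultimately have "p dvd 1"
    using dvd_add_right_iff by blast
  with assms show False by simp
qed

section \<open>A subsum exactly divisible by \<open>p ^ e\<close>\<close>

lemma degree_prod_linear: "finite A \<Longrightarrow> degree (\<Prod>i\<in>A. [:- c i, 1:] :: 'a::idom poly) = card A"
  by (subst degree_prod_eq_sum_degree) auto

lemma lead_coeff_prod_linear:
  "lead_coeff (\<Prod>i\<in>A. [:- c i, 1:] :: 'a::idom poly) = 1"
  by (simp add: lead_coeff_prod)

lemma exists_submultiset_exact_sum:
  fixes S :: "int multiset"
  assumes p: "prime p" and size: "size S = 2 * p ^ e - 1"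
    and cop: "\<forall>a \<in># S. \<not> int p dvd a"
  shows "\<exists>T. T \<subseteq># S \<and> int (p ^ e) dvd \<Sum>\<^sub># T \<and> \<not> int (p * p ^ e) dvd \<Sum>\<^sub># T"
proof (rule ccontr)
  assume none: "\<not> ?thesis"
  define q where "q = p ^ e"
  have q: "q > 0"
    using p prime_gt_0_nat by (simp add: q_def)
  \<comment> \<open>The two binomial factors of the polynomial with denominators cleared, hence
    integral and monic; \<open>M\<close> is the cleared factor.\<close>
  define U V :: "int poly"
    where "U = (\<Prod>i\<in>{0..<q-1}. [:- (1 + int i), 1:])" and "V = (\<Prod>i\<in>{0..<q}. [:- int i, 1:])"
  define M :: int where "M = fact (q - 1) * fact q"
  have deg: "degree U = q - 1" "degree V = q"
    unfolding U_def V_def by (subst degree_prod_linear; simp)+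
  have lead: "lead_coeff U = 1" "lead_coeff V = 1"
    unfolding U_def V_def by (rule lead_coeff_prod_linear)+
  have "U \<noteq> 0" "V \<noteq> 0"
    using lead by auto
  then have deg_UV: "degree (U * V) = size S"
    using deg q size by (simp add: degree_mult_eq q_def)
  have "M * int p dvd poly (U * V) (\<Sum>\<^sub># T)" if "T \<subseteq># S" for T
  proof -
    define s where "s = \<Sum>\<^sub># T"
    have "poly U s = fact (q - 1) * ((s - 1) ichoose (q - 1))"
      unfolding U_def ichoose_mult_fact by (simp add: poly_prod algebra_simps)
    moreover have "poly V s = fact q * (s ichoose q)"
      unfolding V_def ichoose_mult_fact by (simp add: poly_prod)
    ultimately have "poly (U * V) s = M * (((s - 1) ichoose (q - 1)) * (s ichoose q))"
      by (simp add: M_def)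
    moreover have "int p dvd ((s - 1) ichoose (q - 1)) * (s ichoose q)"
      using none that prime_dvd_ichoose_product[OF p, of e s] by (auto simp: q_def s_def)
    ultimately show ?thesis
      by (simp add: s_def)
  qed
  with deg_UV have "M * int p dvd fact (size S) * coeff (U * V) (size S) * \<Prod>\<^sub># S"
    by (intro dvd_iterated_difference) auto
  moreover have "coeff (U * V) (size S) = 1"
    using lead by (metis deg_UV lead_coeff_mult mult_1)
  \<comment> \<open>\<open>M\<close> reappears in the factorial produced by the iterated difference,
    so it cancels.\<close>
  moreover have "fact (size S) = M * int ((2 * q - 1) choose q)"
  proof -
    have "fact q * fact (2 * q - 1 - q) * ((2 * q - 1) choose q) = (fact (2 * q - 1) :: nat)"
      using q by (intro binomial_fact_lemma) simp
    moreover have "2 * q - 1 - q = q - 1" by simp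
    ultimately have "int (fact q * fact (q - 1) * ((2 * q - 1) choose q)) = int (fact (2 * q - 1))"
      by simp
    then show ?thesis
      by (simp add: M_def size q_def mult.commute)
  qed
  ultimately have "M * int p dvd M * (int ((2 * q - 1) choose q) * \<Prod>\<^sub># S)"
    by (simp add: mult.assoc)
  then have "int p dvd int ((2 * q - 1) choose q) * \<Prod>\<^sub># S"
    by (simp add: M_def)
  then have "int p dvd int ((2 * q - 1) choose q) \<or> int p dvd \<Prod>\<^sub># S"
    using p prime_dvd_mult_iff by (metis prime_nat_int_transfer)
  moreover have "\<not> int p dvd \<Prod>\<^sub># S"
    using p cop prime_dvd_prod_mset_iff[of "int p" S] by auto
  moreover have "\<not> int p dvd int ((2 * q - 1) choose q)"
    using prime_not_dvd_choose_twice_prime_power[OF p, of e] by (simp add: q_def)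
  ultimately show False by blast
qed

section \<open>Shortening a selection\<close>

text \<open>Of the \<open>n + 1\<close> prefix sums of lengths 0 to \<open>n\<close>, two agree
  modulo \<open>n\<close>; the block between them works.\<close>

lemma exists_zero_sum_submultiset:
  fixes T :: "int multiset"
  assumes "n > 0" "size T \<ge> n"
  shows "\<exists>J. J \<subseteq># T \<and> J \<noteq> {#} \<and> size J \<le> n \<and> int n dvd \<Sum>\<^sub># J"
proof -
  obtain xs where xs: "mset xs = T"
    using ex_mset by blast
  then have len: "length xs \<ge> n"
    using assms(2) by (metis size_mset)
  let ?f = "\<lambda>k. sum_list (take k xs) mod int n"
  have "?f ` {..n} \<subseteq> {0..<int n}"
    using assms(1) by auto
  then have "card (?f ` {..n}) \<le> n"
    using card_mono[of "{0..<int n}" "?f ` {..n}"] by simp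
  then have "\<not> inj_on ?f {..n}"
    by (intro pigeonhole) simp
  then obtain i j where ij: "i < j" "j \<le> n" "?f i = ?f j"
    unfolding inj_on_def by (metis atMost_iff linorder_neqE_nat)
  let ?ys = "take (j - i) (drop i xs)"
  have split: "take j xs = take i xs @ ?ys"
    using ij(1) by (metis le_add_diff_inverse less_imp_le_nat take_add)
  have "int n dvd sum_list (take j xs) - sum_list (take i xs)"
    using ij(3) by (metis mod_eq_dvd_iff)
  then have "int n dvd \<Sum>\<^sub># (mset ?ys)"
    by (simp add: split sum_mset_sum_list)
  moreover have "mset ?ys \<subseteq># T"
    using xs by (metis append_take_drop_id mset_append mset_subset_eq_add_left
        mset_subset_eq_add_right subset_mset.order_trans)
  moreover have "length ?ys = j - i"
    using ij len by simp
  then have "mset ?ys \<noteq> {#}" "size (mset ?ys) \<le> n"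
    using ij by auto
  ultimately show ?thesis by blast
qed

text \<open>If a short block with sum divisible by \<open>n\<close> fails, \<open>m\<close> divides
  its sum, and removing it preserves both divisibility conditions on \<open>T\<close>.\<close>

lemma exists_short_submultiset_exact_sum:
  fixes T :: "int multiset"
  assumes "n > 0" "int n dvd m" "int n dvd \<Sum>\<^sub># T" "\<not> m dvd \<Sum>\<^sub># T"
  shows "\<exists>J. J \<subseteq># T \<and> size J \<le> n \<and> int n dvd \<Sum>\<^sub># J \<and> \<not> m dvd \<Sum>\<^sub># J"
  using assms(3,4)
proof (induction "size T" arbitrary: T rule: less_induct)
  case less
  show ?case
  proof (cases "size T \<le> n")
    case True
    with less.prems show ?thesis by blast
  next
    case False
    then obtain J where J: "J \<subseteq># T" "J \<noteq> {#}" "size J \<le> n" "int n dvd \<Sum>\<^sub># J"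
      using exists_zero_sum_submultiset[of n T] assms(1) by auto
    show ?thesis
    proof (cases "m dvd \<Sum>\<^sub># J")
      case False
      with J show ?thesis by blast
    next
      case True
      have sum: "\<Sum>\<^sub># (T - J) = \<Sum>\<^sub># T - \<Sum>\<^sub># J"
        using J(1) by (rule sum_mset_diff)
      have "size (T - J) < size T"
        using J(1,2) by (metis size_Diff_submset diff_less nonempty_has_size
            order_less_le_trans size_mset_mono)
      moreover have "int n dvd \<Sum>\<^sub># (T - J)"
        using less.prems(1) J(4) by (simp add: sum)
      moreover have "\<not> m dvd \<Sum>\<^sub># (T - J)"
        using less.prems(2) True by (metis sum diff_add_cancel dvd_add)
      ultimately obtain K where
        "K \<subseteq># T - J" "size K \<le> n" "int n dvd \<Sum>\<^sub># K" "\<not> m dvd \<Sum>\<^sub># K"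
        using less.hyps by blast
      then show ?thesis
        by (meson diff_subset_eq_self subset_mset.order_trans)
    qed
  qed
qed

text \<open>Gives the upper bound for both constants, since dropping the size condition leaves the
  property for \<open>D_unit\<close>.\<close>

lemma eta_unit_property:
  fixes S :: "int multiset"
  assumes "primepow n" "size S = 2 * n - 1" "\<forall>a \<in># S. coprime a (int n)"
  shows "\<exists>T. T \<subseteq># S \<and> T \<noteq> {#} \<and> size T \<le> n \<and> gcd (\<Sum>\<^sub># T) ((int n)\<^sup>2) = int n"
proof -
  obtain p e where pe: "prime p" "e > 0" "n = p ^ e"
    using assms(1) by (auto simp: primepow_def)
  have "\<not> int p dvd a" if "a \<in># S" for a
  proof
    assume "int p dvd a"
    moreover have "int p dvd int n"
      using pe by simp
    ultimately have "is_unit (int p)"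
      using assms(3) that by (meson coprime_common_divisor)
    with pe(1) show False by simp
  qed
  then obtain T0 where T0: "T0 \<subseteq># S" "int n dvd \<Sum>\<^sub># T0" "\<not> int (p * n) dvd \<Sum>\<^sub># T0"
    using exists_submultiset_exact_sum[of p S e] pe assms(2) by auto
  have "n > 0"
    using assms(1) primepow_gt_0_nat by blast
  then obtain T where T: "T \<subseteq># T0" "size T \<le> n" "int n dvd \<Sum>\<^sub># T" "\<not> int (p * n) dvd \<Sum>\<^sub># T"
    using exists_short_submultiset_exact_sum[of n "int (p * n)" T0] T0 by auto
  \<comment> \<open>The empty sum 0 would be divisible by \<open>p * n\<close>.\<close>
  have "T \<noteq> {#}"
    using T(4) by auto
  moreover have "gcd (\<Sum>\<^sub># T) ((int n)\<^sup>2) = int n"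
    using T pe gcd_prime_power_square_eq[of p e "\<Sum>\<^sub># T"] by simp
  ultimately show ?thesis
    using T T0(1) by (meson subset_mset.order_trans)
qed

section \<open>The lower bound\<close>

text \<open>Subsums have absolute value below \<open>n\<close>, so one divisible by \<open>n\<close>
  is 0, and its gcd is the square of \<open>n\<close>.\<close>

lemma submultiset_replicate_pm1_gcd:
  assumes "n \<ge> 2" "i < n" "j < n"
    and T: "T \<subseteq># replicate_mset i (1::int) + replicate_mset j (- 1)"
  shows "gcd (\<Sum>\<^sub># T) ((int n)\<^sup>2) \<noteq> int n"
proof
  assume gcd: "gcd (\<Sum>\<^sub># T) ((int n)\<^sup>2) = int n"
  let ?A = "replicate_mset i (1::int)" and ?B = "replicate_mset j (- 1 :: int)"
  obtain a where a: "a \<le> i" "T \<inter># ?A = replicate_mset a 1"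
    by (metis msubseteq_replicate_msetE subset_mset.inf_le2)
  have "T - ?A \<subseteq># ?B"
    using T by (simp add: subset_eq_diff_conv add.commute)
  then obtain b where b: "b \<le> j" "T - ?A = replicate_mset b (- 1)"
    by (metis msubseteq_replicate_msetE)
  have "T = (T \<inter># ?A) + (T - ?A)"
    by (rule multiset_eqI) simp
  then have "\<Sum>\<^sub># T = int a - int b"
    unfolding a b by simp
  moreover have "\<bar>int a - int b\<bar> < int n"
    using a(1) b(1) assms(2,3) by linarith
  moreover have "int n dvd \<Sum>\<^sub># T"
    using gcd by (metis gcd_dvd1)
  ultimately have "\<Sum>\<^sub># T = 0"
    using dvd_imp_le_int[of "\<Sum>\<^sub># T" "int n"] by fastforce
  with gcd have "int n * int n = int n * 1"
    by (simp add: power2_eq_square)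
  with assms(1) show False by simp
qed

lemma D_unit_property_ge:
  assumes "n \<ge> 2"
    and "\<forall>S :: int multiset. size S = l \<longrightarrow> (\<forall>a \<in># S. coprime a (int n)) \<longrightarrow>
        (\<exists>T. T \<subseteq># S \<and> T \<noteq> {#} \<and> gcd (\<Sum>\<^sub># T) ((int n)\<^sup>2) = int n)"
  shows "2 * n - 1 \<le> l"
proof (rule ccontr)
  assume less: "\<not> 2 * n - 1 \<le> l"
  \<comment> \<open>As many ones as allowed; since l \<le> 2 n - 2, at most \<open>n - 1\<close>
    minus ones remain. Every shorter length is thus excluded.\<close>
  define i where "i = min l (n - 1)"
  define S where "S = replicate_mset i (1::int) + replicate_mset (l - i) (- 1)"
  have i: "i < n" "l - i < n" "i \<le> l"
    using less assms(1) by (auto simp: i_def)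
  have "size S = l"
    using i by (simp add: S_def)
  moreover have "\<forall>a \<in># S. coprime a (int n)"
    by (auto simp: S_def split: if_splits)
  ultimately obtain T where "T \<subseteq># S" "gcd (\<Sum>\<^sub># T) ((int n)\<^sup>2) = int n"
    using assms(2) by blast
  with submultiset_replicate_pm1_gcd[OF assms(1) i(1,2)] show False
    by (auto simp: S_def)
qed

theorem theorem1p4:
  fixes n :: nat
  assumes "primepow n"
  shows "D_unit n = 2 * n - 1 \<and> eta_unit n = 2 * n - 1"
proof
  have n: "n \<ge> 2"
    using primepow_gt_Suc_0[OF assms] by simp
  show "D_unit n = 2 * n - 1"
    unfolding D_unit_def
  proof (rule cInf_eq_minimum, goal_cases)
    case 1
    show ?case
      using n eta_unit_property[OF assms] by auto
  next
    case (2 l)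
    then show ?case
      using D_unit_property_ge[OF n] by blast
  qed
  show "eta_unit n = 2 * n - 1"
    unfolding eta_unit_def
  proof (rule cInf_eq_minimum, goal_cases)
    case 1
    show ?case
      using n eta_unit_property[OF assms] by auto
  next
    case (2 l)
    \<comment> \<open>A length admissible for \<open>eta_unit\<close> is admissible for
      \<open>D_unit\<close>, so the same lower bound applies.\<close>
    then have "\<forall>S :: int multiset. size S = l \<longrightarrow> (\<forall>a \<in># S. coprime a (int n)) \<longrightarrow>
        (\<exists>T. T \<subseteq># S \<and> T \<noteq> {#} \<and> gcd (\<Sum>\<^sub># T) ((int n)\<^sup>2) = int n)"
      by blast
    then show ?case
      by (rule D_unit_property_ge[OF n])
  qed
qed

end
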